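(* Let $s\ge 1$. Then for each stationary point $(\overline T,(\overline K_k,\overline\Phi_k)_{k=1}^{N_K})$ of $J$ with associated state $\overline x$ such that the constraints $$0\le \overline T\le T_{\max},\qquad \alpha(\overline K_k)\le 1,\qquad \beta(\overline\Phi_k)\le 1,\qquad \overline K_k\mathbf{1}=0\in\mathbb{R}^m\qquad(k=1,\dots,N_K)$$ and the state equation $$\dot{\overline x}(t)=\overline T\Big(-A^\top(A\overline x(t)-b)-\sum_{k=1}^{N_K}\overline K_k^\top\overline\Phi_k(\overline K_k\overline x(t))\Big)\quad\text{for } t\in(0,1),\qquad \overline x(0)=x_0,$$ are valid, the equation $$\int_0^1\langle\overline p(t),\dot{\overline x}(t)\rangle\,\mathrm{d}t=0$$ holds true. Here, $\overline p\in C^1([0,1],\mathbb{R}^n)$ denotes the adjoint state of $\overline x$, which is given as the solution to the ordinary differential equation $$\dot{\overline p}(t)=\sum_{k=1}^{N_K}\overline T\,\overline K_k^\top D\overline\Phi_k(\overline K_k\overline x(t))\overline K_k\overline p(t)+\overline TA^\top A\overline p(t)$$ with terminal condition $\overline p(1)=x_g-\overline x(1)$.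
   Context: Fixed data: positive integers $n,m,l,N_K$ and $N_w\ge 1$; a matrix $A\in\mathbb{R}^{l\times n}$; vectors $b\in\mathbb{R}^l$ and $x_0,x_g\in\mathbb{R}^n$ (initial value and ground truth); a constant $T_{\max}>0$. $\mathbf{1}=(1,\dots,1)^\top\in\mathbb{R}^n$, and $\langle\cdot,\cdot\rangle$ is the Euclidean inner product. Activation functions: fix a bounded open interval $I\subset\mathbb{R}$ and $C^s(\mathbb{R},\mathbb{R})$-conforming basis functions $\psi_1,\dots,\psi_{N_w}$ with compact support in $\overline I$. Define $$\mathcal{V}^s=\Big\{\Phi=(\phi,\dots,\phi):\mathbb{R}^m\to\mathbb{R}^m \;\Big|\; \phi=\sum_{j=1}^{N_w}w_j\psi_j\Big\},$$ with weight vectors $w\in\mathbb{R}^{N_w}$, where $\Phi$ consists of $m$ identical component functions and acts componentwise, $\Phi(y_1,\dots,y_m)=(\phi(y_1),\dots,\phi(y_m))^\top$; $D\Phi$ is its Jacobian. $\|\cdot\|$ denotes a norm on $\mathbb{R}^{m\times n}$ and on $\mathcal{V}^s$, respectively. Constraint functions: $\alpha:\mathbb{R}^{m\times n}\to\mathbb{R}_0^+=[0,\infty)$ and $\beta:\mathcal{V}^s\to\mathbb{R}_0^+$ are continuously differentiable functions with non-vanishing gradient such that $\alpha(K)\to\infty$ and $\beta(\Phi)\to\infty$ as $\|K\|\to\infty$ and $\|\Phi\|\to\infty$. Cost functional and optimal control problem: for controls $T\in\mathbb{R}$, $K_k\in\mathbb{R}^{m\times n}$, $\Phi_k\in\mathcal{V}^s$,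 $k=1,\dots,N_K$, $$J(T,(K_k,\Phi_k)_{k=1}^{N_K})=\tfrac12\|x(1)-x_g\|_2^2,$$ where $x$ is the associated state, i.e. the solution of $\dot x(t)=T\big(-A^\top(Ax(t)-b)-\sum_{k=1}^{N_K}K_k^\top\Phi_k(K_kx(t))\big)$ for $t\in(0,1)$, $x(0)=x_0$. The optimal control problem is to minimize $J$ over the controls subject to $0\le T\le T_{\max}$, $\alpha(K_k)\le1$, $\beta(\Phi_k)\le1$, $K_k\mathbf{1}=0$ and this state equation; stationary points of $J$ are understood for this constrained problem.
   Formalization: Stationary points are read as KKT points with zero multiplier for T ≤ T_max (the claim fails at T = T_max with a positive multiplier); the gradients of α and β are required to be non-vanishing only where α = 1 or β = 1, since coercive C¹ functions have a minimiser. *)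

theory Defs
  imports "HOL-Analysis.Analysis"
begin

text \<open>
  Dimensions are finite index types: \<open>'n\<close>, \<open>'m\<close>, \<open>'l\<close> for the spaces
  \<open>\<real>\<^sup>n\<close>, \<open>\<real>\<^sup>m\<close>, \<open>\<real>\<^sup>l\<close>, \<open>'k\<close> for the \<open>N\<^sub>K\<close> kernels and \<open>'w\<close> for the \<open>N\<^sub>w\<close> basis
  functions. An \<open>m \<times> n\<close> matrix has type \<open>real^'n^'m\<close>.
\<close>

subsection \<open>Activation functions\<close>

definition Ck_real :: "nat \<Rightarrow> (real \<Rightarrow> real) \<Rightarrow> bool" where
  "Ck_real s f \<longleftrightarrow>
     (\<forall>i<s. \<forall>x. ((deriv ^^ i) f) field_differentiable (at x)) \<and>
     continuous_on UNIV ((deriv ^^ s) f)"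

definition basis_functions :: "nat \<Rightarrow> real \<Rightarrow> real \<Rightarrow> ('w::finite \<Rightarrow> real \<Rightarrow> real) \<Rightarrow> bool" where
  "basis_functions s lo hi \<psi> \<longleftrightarrow>
     (\<forall>j. Ck_real s (\<psi> j) \<and> closure {x. \<psi> j x \<noteq> 0} \<subseteq> closure {lo<..<hi}) \<and>
     (\<forall>w :: real^'w. (\<forall>x. (\<Sum>j\<in>UNIV. w $ j * \<psi> j x) = 0) \<longrightarrow> w = 0)"

definition activation ::
  "('w::finite \<Rightarrow> real \<Rightarrow> real) \<Rightarrow> real^'w \<Rightarrow> real^'m \<Rightarrow> real^'m" where
  "activation \<psi> w = (\<lambda>y. \<chi> i. \<Sum>j\<in>UNIV. w $ j * \<psi> j (y $ i))"

definition activation_space ::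
  "('w::finite \<Rightarrow> real \<Rightarrow> real) \<Rightarrow> (real^'m \<Rightarrow> real^'m) set" where
  "activation_space \<psi> = range (activation \<psi>)"

subsection \<open>Constraint functions\<close>

text \<open>
  The gradient is required not to vanish where the constraint \<open>f \<le> 1\<close> is active. It cannot be
  nonzero everywhere: a coercive \<open>C\<^sup>1\<close> function has a global minimiser.
\<close>

definition constraint_function :: "('a::euclidean_space \<Rightarrow> real) \<Rightarrow> bool" where
  "constraint_function f \<longleftrightarrow>
     (\<forall>x. 0 \<le> f x) \<and>
     (\<exists>g. (\<forall>x. GDERIV f x :> g x) \<and> continuous_on UNIV g \<and> (\<forall>x. f x = 1 \<longrightarrow> g x \<noteq> 0)) \<and>
     filterlim f at_top at_infinity"

text \<open>
  For a function on the finite-dimensional activation space, all of this is expressed in the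
  coordinates with respect to the basis functions. Since all norms on the
  space are equivalent, coercivity does not depend on the norm chosen.
\<close>

definition activation_constraint_function ::
  "('w::finite \<Rightarrow> real \<Rightarrow> real) \<Rightarrow> ((real^'m \<Rightarrow> real^'m) \<Rightarrow> real) \<Rightarrow> bool" where
  "activation_constraint_function \<psi> \<beta> \<longleftrightarrow> constraint_function (\<lambda>w. \<beta> (activation \<psi> w))"

subsection \<open>State equation, cost functional and adjoint equation\<close>

definition vector_field ::
  "real^'n^'l \<Rightarrow> real^'l \<Rightarrow> real^'n^'m^'k \<Rightarrow> ('k::finite \<Rightarrow> real^'m \<Rightarrow> real^'m) \<Rightarrow> real^'n \<Rightarrow> real^'n"
where
  "vector_field A b K \<Phi> x =
     - (transpose A *v (A *v x - b)) - (\<Sum>k\<in>UNIV. transpose (K $ k) *v \<Phi> k (K $ k *v x))"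

definition is_state ::
  "real^'n^'l \<Rightarrow> real^'l \<Rightarrow> real^'n \<Rightarrow> real \<Rightarrow> real^'n^'m^'k \<Rightarrow> ('k::finite \<Rightarrow> real^'m \<Rightarrow> real^'m) \<Rightarrow>
   (real \<Rightarrow> real^'n) \<Rightarrow> bool"
where
  "is_state A b x0 T K \<Phi> x \<longleftrightarrow>
     continuous_on {0..1} x \<and> x 0 = x0 \<and>
     (\<forall>t\<in>{0<..<1}. (x has_vector_derivative (T *\<^sub>R vector_field A b K \<Phi> (x t))) (at t))"

text \<open>
  The state is unique on the interval from 0 to 1 for the activation functions considered here, so
  \<open>x 1\<close> does not depend on the choice made by the selection operator.
\<close>

definition cost ::
  "real^'n^'l \<Rightarrow> real^'l \<Rightarrow> real^'n \<Rightarrow> real^'n \<Rightarrow> real \<Rightarrow> real^'n^'m^'k \<Rightarrow>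
   ('k::finite \<Rightarrow> real^'m \<Rightarrow> real^'m) \<Rightarrow> real"
where
  "cost A b x0 xg T K \<Phi> =
     (let x = (SOME x. is_state A b x0 T K \<Phi> x) in 1 / 2 * (norm (x 1 - xg))\<^sup>2)"

definition is_adjoint_state ::
  "real^'n^'l \<Rightarrow> real^'n \<Rightarrow> real \<Rightarrow> real^'n^'m^'k \<Rightarrow> ('k::finite \<Rightarrow> real^'m \<Rightarrow> real^'m) \<Rightarrow>
   (real \<Rightarrow> real^'n) \<Rightarrow> (real \<Rightarrow> real^'n) \<Rightarrow> bool"
where
  "is_adjoint_state A xg T K \<Phi> x p \<longleftrightarrow>
     (\<forall>t\<in>{0..1}. (p has_vector_derivative
        (\<Sum>k\<in>UNIV. T *\<^sub>R (transpose (K $ k) *v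
           (jacobian (\<Phi> k) (at (K $ k *v x t)) *v (K $ k *v p t))))
        + T *\<^sub>R (transpose A *v (A *v p t))) (at t within {0..1})) \<and>
     p 1 = xg - x 1"

subsection \<open>Stationary points\<close>

text \<open>
  The Karush-Kuhn-Tucker system of the problem of minimising the cost functional under the
  constraints \<open>0 \<le> T \<le> Tmax\<close>, \<open>\<alpha> (K\<^sub>k) \<le> 1\<close>, \<open>\<beta> (\<Phi>\<^sub>k) \<le> 1\<close> and \<open>K\<^sub>k 1 = 0\<close>, the state being
  eliminated by the state equation. The multipliers belong, in this order, to \<open>0 \<le> T\<close>,
  \<open>T \<le> Tmax\<close>, and to the constraints on \<open>\<alpha>\<close>, \<open>\<beta>\<close> and the row sums. Derivatives with
  respect to \<open>\<Phi>\<^sub>k\<close> are taken in the coordinates \<open>w $ k\<close>.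
\<close>

definition kkt_system ::
  "real^'n^'l \<Rightarrow> real^'l \<Rightarrow> real^'n \<Rightarrow> real^'n \<Rightarrow> real \<Rightarrow> ('w::finite \<Rightarrow> real \<Rightarrow> real) \<Rightarrow>
   (real^'n^'m \<Rightarrow> real) \<Rightarrow> ((real^'m \<Rightarrow> real^'m) \<Rightarrow> real) \<Rightarrow>
   real \<Rightarrow> real^'n^'m^'k \<Rightarrow> real^'w^'k \<Rightarrow>
   real \<Rightarrow> real \<Rightarrow> real^'k \<Rightarrow> real^'k \<Rightarrow> real^'m^'k::finite \<Rightarrow> bool"
where
  "kkt_system A b x0 xg Tmax \<psi> \<alpha> \<beta> T K w \<eta>0 \<eta>1 \<mu> \<nu> \<xi> \<longleftrightarrow>
     (0 \<le> T \<and> T \<le> Tmax \<and>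
      (\<forall>k. \<alpha> (K $ k) \<le> 1 \<and> \<beta> (activation \<psi> (w $ k)) \<le> 1 \<and> K $ k *v vec 1 = 0)) \<and>
     (0 \<le> \<eta>0 \<and> 0 \<le> \<eta>1 \<and> (\<forall>k. 0 \<le> \<mu> $ k \<and> 0 \<le> \<nu> $ k)) \<and>
     (\<eta>0 * T = 0 \<and> \<eta>1 * (T - Tmax) = 0 \<and>
      (\<forall>k. \<mu> $ k * (\<alpha> (K $ k) - 1) = 0 \<and> \<nu> $ k * (\<beta> (activation \<psi> (w $ k)) - 1) = 0)) \<and>
     (\<exists>J'. ((\<lambda>(T, K, w). cost A b x0 xg T K (\<lambda>k. activation \<psi> (w $ k)))
              has_derivative J') (at (T, K, w)) \<and>
        (\<forall>dT dK dw.
           J' (dT, dK, dw) - \<eta>0 * dT + \<eta>1 * dT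
           + (\<Sum>k\<in>UNIV. \<mu> $ k * frechet_derivative \<alpha> (at (K $ k)) (dK $ k))
           + (\<Sum>k\<in>UNIV. \<nu> $ k *
                frechet_derivative (\<lambda>v. \<beta> (activation \<psi> v)) (at (w $ k)) (dw $ k))
           + (\<Sum>k\<in>UNIV. \<xi> $ k \<bullet> (dK $ k *v vec 1)) = 0))"

text \<open>
  The multiplier of \<open>T \<le> Tmax\<close> is zero here: \<open>Tmax\<close> is an artificial bound that ensures
  existence of minimisers, and stationarity in \<open>T\<close> must not be enforced by it. For
  \<open>T < Tmax\<close> this is no restriction, by complementarity. At \<open>T = Tmax\<close> a positive
  multiplier makes the integral of \<open>\<langle>p, x'\<rangle>\<close> equal to
  \<open>\<eta>1 * Tmax\<close>: for \<open>n = m = l = N\<^sub>K = 1\<close>, \<open>A = 1\<close>, \<open>b = 0\<close>, \<open>x0 = 1\<close>,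
  \<open>xg = 0\<close> the constraints force \<open>K = 0\<close>, the state is \<open>exp (- T * t)\<close>, the optimal
  \<open>T\<close> is \<open>Tmax\<close>, and the integral is \<open>Tmax * exp (- 2 * Tmax)\<close>.
\<close>

definition stationary_point ::
  "real^'n^'l \<Rightarrow> real^'l \<Rightarrow> real^'n \<Rightarrow> real^'n \<Rightarrow> real \<Rightarrow> ('w::finite \<Rightarrow> real \<Rightarrow> real) \<Rightarrow>
   (real^'n^'m \<Rightarrow> real) \<Rightarrow> ((real^'m \<Rightarrow> real^'m) \<Rightarrow> real) \<Rightarrow>
   real \<Rightarrow> real^'n^'m^'k \<Rightarrow> ('k::finite \<Rightarrow> real^'m \<Rightarrow> real^'m) \<Rightarrow> bool"
where
  "stationary_point A b x0 xg Tmax \<psi> \<alpha> \<beta> T K \<Phi> \<longleftrightarrow>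
     (\<exists>w \<eta>0 \<mu> \<nu> \<xi>. (\<forall>k. \<Phi> k = activation \<psi> (w $ k)) \<and>
        kkt_system A b x0 xg Tmax \<psi> \<alpha> \<beta> T K w \<eta>0 0 \<mu> \<nu> \<xi>)"

end

theory Submission
  imports Defs
begin

text \<open>
  Write the state equation as \<open>x' = T f(x)\<close> with the autonomous vector field \<open>f\<close>.

  Because \<open>\<Phi>\<^sub>k\<close> acts componentwise, its Jacobian is diagonal, so \<open>Df\<close> is pointwise self-adjoint
  (\<open>f\<close> is minus a gradient). The adjoint equation is therefore \<open>p' = - T Df(x) p\<close>, while
  differentiating \<open>f(x(t))\<close> gives \<open>T Df(x) f(x)\<close>; the two contributions to the derivative of
  \<open>\<langle>p, f(x)\<rangle>\<close> cancel, and \<open>\<langle>p, f(x)\<rangle>\<close> is constant, equal to its final value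
  \<open>\<langle>xg - x(1), f(x(1))\<rangle>\<close> (lemma \<open>adjoint_inner_vector_field_constant\<close>).

  This final value is minus the derivative of the cost with respect to \<open>T\<close>. Indeed, \<open>T\<close> only
  rescales time: for \<open>0 \<le> c \<le> 1\<close> the state with end time \<open>c T\<close> is \<open>x(c t)\<close>, so the cost at
  \<open>c T\<close> is \<open>1/2 |x(c) - xg|\<^sup>2\<close>, whose left derivative at \<open>c = 1\<close> is \<open>T \<langle>x(1) - xg, f(x(1))\<rangle>\<close>
  (lemma \<open>cost_derivative_time\<close>). A left derivative suffices, because the cost is differentiable
  at a stationary point. That \<open>x(c t)\<close> is the only state for the end time \<open>c T\<close>
  follows from a global Lipschitz bound for \<open>f\<close>, which holds because the basis functions are
  \<open>C\<^sup>1\<close> with compact support (lemmas \<open>vector_field_lipschitz\<close> and \<open>lipschitz_ode_unique\<close>).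

  Finally, stationarity in the direction of \<open>T\<close> says that the derivative of the cost with respect
  to \<open>T\<close> is the multiplier \<open>\<eta>0\<close> of \<open>0 \<le> T\<close> (lemma \<open>stationary_point_time_derivative\<close>), and
  complementarity gives \<open>\<eta>0 T = 0\<close>. Hence for \<open>T > 0\<close> the constant \<open>\<langle>p, f(x)\<rangle>\<close> is zero, and
  in every case the integrand \<open>\<langle>p, x'\<rangle> = T \<langle>p, f(x)\<rangle>\<close> vanishes.
\<close>

section \<open>Regularity of the activation functions\<close>

lemma Ck_real_imp_C1:
  assumes "Ck_real s f" and "s \<ge> 1"
  shows "(f has_real_derivative deriv f x) (at x)"
    and "continuous_on UNIV (deriv f)"
proof -
  show "(f has_real_derivative deriv f x) (at x)"
    using assms by (force simp: Ck_real_def DERIV_deriv_iff_field_differentiable)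
  show "continuous_on UNIV (deriv f)"
  proof (cases "s = 1")
    case True
    then show ?thesis using assms by (simp add: Ck_real_def)
  next
    case False
    then have "1 < s" using assms by simp
    then have "\<forall>x. ((deriv ^^ 1) f) field_differentiable (at x)"
      using assms unfolding Ck_real_def by blast
    then show ?thesis
      by (simp add: continuous_on_eq_continuous_at field_differentiable_imp_continuous_at)
  qed
qed

text \<open>
  The derivative vanishes off the compact interval and is continuous on it, so it is bounded and
  the mean value theorem applies.
\<close>

lemma basis_function_lipschitz:
  assumes "basis_functions s lo hi \<psi>" and "s \<ge> 1"
  obtains L where "L-lipschitz_on UNIV (\<psi> j)"
proof -
  have Ck: "Ck_real s (\<psi> j)"
    and supp: "closure {x. \<psi> j x \<noteq> 0} \<subseteq> closure {lo<..<hi}"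
    using assms by (auto simp: basis_functions_def)
  note C1 = Ck_real_imp_C1[OF Ck \<open>s \<ge> 1\<close>]
  have "compact (closure {lo<..<hi})"
    by (simp add: compact_closure)
  then have "compact (deriv (\<psi> j) ` closure {lo<..<hi})"
    using C1(2) by (metis compact_continuous_image continuous_on_subset subset_UNIV)
  then obtain B where B: "B > 0" "\<And>x. x \<in> closure {lo<..<hi} \<Longrightarrow> norm (deriv (\<psi> j) x) \<le> B"
    by (force dest!: compact_imp_bounded simp: bounded_pos)
  have off: "deriv (\<psi> j) x = 0" if "x \<notin> closure {lo<..<hi}" for x
  proof -
    have "\<psi> j y = 0" if "y \<in> - closure {lo<..<hi}" for y
      using that supp closure_subset[of "{x. \<psi> j x \<noteq> 0}"] by blast
    then have "(\<psi> j has_real_derivative 0) (at x)"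
      using that
      by (subst DERIV_cong_ev[OF refl _ refl, where g = "\<lambda>_. 0"])
         (auto simp: eventually_nhds intro!: exI[of _ "- closure {lo<..<hi}"])
    then show ?thesis by (rule DERIV_imp_deriv)
  qed
  have bound: "norm (deriv (\<psi> j) x) \<le> B" for x
    using B off by (cases "x \<in> closure {lo<..<hi}") auto
  have "B-lipschitz_on UNIV (\<psi> j)"
  proof (rule lipschitz_onI)
    fix x y
    show "dist (\<psi> j x) (\<psi> j y) \<le> B * dist x y"
      unfolding dist_norm
      using C1(1) bound by (intro field_differentiable_bound[of UNIV]) auto
  qed (use B in simp)
  then show ?thesis by (rule that)
qed

lemma activation_lipschitz:
  fixes w :: "real^'w::finite"
  assumes "basis_functions s lo hi \<psi>" and "s \<ge> 1"
  obtains L where "L-lipschitz_on UNIV (activation \<psi> w :: real^'m \<Rightarrow> real^'m)"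
proof -
  have "\<forall>j. \<exists>L. L-lipschitz_on UNIV (\<psi> j)"
    using basis_function_lipschitz[OF assms] by blast
  then obtain L where L: "\<And>j. (L j)-lipschitz_on UNIV (\<psi> j)"
    by metis
  define C where "C = (\<Sum>j\<in>UNIV. \<bar>w $ j\<bar> * L j)"
  have C: "C \<ge> 0"
    unfolding C_def using lipschitz_on_nonneg[OF L] by (intro sum_nonneg mult_nonneg_nonneg) auto
  have "C-lipschitz_on UNIV (activation \<psi> w :: real^'m \<Rightarrow> real^'m)"
  proof (rule lipschitz_onI[OF _ C])
    fix u v :: "real^'m"
    have "norm (activation \<psi> w u - activation \<psi> w v) \<le> norm (C *\<^sub>R (u - v))"
    proof (rule norm_le_componentwise_cart)
      fix i
      have "norm ((activation \<psi> w u - activation \<psi> w v) $ i)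
            = \<bar>\<Sum>j\<in>UNIV. w $ j * (\<psi> j (u $ i) - \<psi> j (v $ i))\<bar>"
        by (simp add: activation_def sum_subtractf right_diff_distrib)
      also have "\<dots> \<le> (\<Sum>j\<in>UNIV. \<bar>w $ j\<bar> * (L j * \<bar>u $ i - v $ i\<bar>))"
        using lipschitz_on_normD[OF L]
        by (intro order_trans[OF sum_abs] sum_mono) (auto simp: abs_mult intro!: mult_left_mono)
      also have "\<dots> = C * \<bar>u $ i - v $ i\<bar>"
        by (simp add: C_def sum_distrib_right mult.assoc)
      also have "\<dots> = norm ((C *\<^sub>R (u - v)) $ i)"
        using C by (simp add: abs_mult flip: right_diff_distrib)
      finally show "norm ((activation \<psi> w u - activation \<psi> w v) $ i) \<le> norm ((C *\<^sub>R (u - v)) $ i)" .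
    qed
    then show "dist (activation \<psi> w u) (activation \<psi> w v) \<le> C * dist u v"
      using C by (simp add: dist_norm)
  qed
  then show ?thesis by (rule that)
qed

text \<open>The Jacobian is diagonal, because each component depends on its own coordinate only.\<close>

lemma activation_jacobian:
  fixes w :: "real^'w::finite" and y :: "real^'m"
  assumes "basis_functions s lo hi \<psi>" and "s \<ge> 1"
  shows "(activation \<psi> w has_derivative (\<lambda>h. jacobian (activation \<psi> w) (at y) *v h)) (at y)"
    and "u \<bullet> (jacobian (activation \<psi> w) (at y) *v v)
         = (jacobian (activation \<psi> w) (at y) *v u) \<bullet> v"
proof -
  define D where "D = (\<lambda>h::real^'m. \<chi> i. (\<Sum>j\<in>UNIV. w $ j * deriv (\<psi> j) (y $ i)) * h $ i)"
  have "Ck_real s (\<psi> j)" for j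
    using assms by (auto simp: basis_functions_def)
  note der = Ck_real_imp_C1(1)[OF this \<open>s \<ge> 1\<close>]
  have comp: "((\<lambda>x::real^'m. \<psi> j (x $ i)) has_derivative (\<lambda>h. deriv (\<psi> j) (y $ i) * h $ i)) (at y)"
    for i j
    by (rule has_derivative_compose[OF bounded_linear_imp_has_derivative[OF bounded_linear_vec_nth]
          der[unfolded has_field_derivative_def]])
  have D: "(activation \<psi> w has_derivative D) (at y)"
    unfolding has_derivative_componentwise_within[of "activation \<psi> w"]
  proof
    fix e :: "real^'m"
    assume "e \<in> Basis"
    then obtain i where i: "e = axis i 1" by (auto simp: Basis_vec_def)
    have "((\<lambda>x::real^'m. \<Sum>j\<in>UNIV. w $ j * \<psi> j (x $ i)) has_derivative
           (\<lambda>h. \<Sum>j\<in>UNIV. w $ j * (deriv (\<psi> j) (y $ i) * h $ i))) (at y)"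
      by (intro has_derivative_sum has_derivative_mult_right comp)
    then show "((\<lambda>x. activation \<psi> w x \<bullet> e) has_derivative (\<lambda>x. D x \<bullet> e)) (at y)"
      by (simp add: i inner_axis activation_def D_def sum_distrib_right mult.assoc)
  qed
  then show J: "(activation \<psi> w has_derivative (\<lambda>h. jacobian (activation \<psi> w) (at y) *v h)) (at y)"
    using jacobian_works differentiable_def by blast
  have "(\<lambda>h. jacobian (activation \<psi> w) (at y) *v h) = D"
    by (rule has_derivative_unique[OF J D])
  then have "jacobian (activation \<psi> w) (at y) *v h = D h" for h
    by metis
  then show "u \<bullet> (jacobian (activation \<psi> w) (at y) *v v)
             = (jacobian (activation \<psi> w) (at y) *v u) \<bullet> v"
    by (simp add: D_def inner_vec_def algebra_simps)
qed

section \<open>The vector field and its linearization\<close>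

definition linearized_field ::
  "real^'n^'l \<Rightarrow> real^'n^'m^'k \<Rightarrow> ('k::finite \<Rightarrow> real^'m \<Rightarrow> real^'m) \<Rightarrow> real^'n \<Rightarrow> real^'n \<Rightarrow> real^'n"
where
  "linearized_field A K \<Phi> x h =
     - (transpose A *v (A *v h))
     - (\<Sum>k\<in>UNIV. transpose (K $ k) *v (jacobian (\<Phi> k) (at (K $ k *v x)) *v (K $ k *v h)))"

lemma vector_field_has_derivative:
  assumes "\<And>k y. (\<Phi> k has_derivative (\<lambda>h. jacobian (\<Phi> k) (at y) *v h)) (at y)"
  shows "(vector_field A b K \<Phi> has_derivative linearized_field A K \<Phi> x) (at x)"
proof -
  note mat = bounded_linear.has_derivative[OF matrix_vector_mul_bounded_linear]
  note lin = mat[OF has_derivative_ident]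
  have "((\<lambda>x. \<Phi> k (K $ k *v x)) has_derivative
         (\<lambda>h. jacobian (\<Phi> k) (at (K $ k *v x)) *v (K $ k *v h))) (at x)" for k
    by (rule has_derivative_compose[of "\<lambda>x. K $ k *v x", OF lin assms])
  moreover have "((\<lambda>x. A *v x - b) has_derivative (\<lambda>h. A *v h)) (at x)"
    using has_derivative_diff[OF lin has_derivative_const] by simp
  ultimately have "((\<lambda>x. - (transpose A *v (A *v x - b))
      - (\<Sum>k\<in>UNIV. transpose (K $ k) *v \<Phi> k (K $ k *v x))) has_derivative
      (\<lambda>h. - (transpose A *v (A *v h))
      - (\<Sum>k\<in>UNIV. transpose (K $ k) *v (jacobian (\<Phi> k) (at (K $ k *v x)) *v (K $ k *v h))))) (at x)"
    by (intro has_derivative_diff has_derivative_minus has_derivative_sum mat)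
  then show ?thesis
    unfolding vector_field_def[abs_def] linearized_field_def[abs_def] .
qed

lemma inner_transpose_matrix_vector:
  fixes M :: "real^'n^'m"
  shows "u \<bullet> (transpose M *v v) = (M *v u) \<bullet> v"
    and "(transpose M *v v) \<bullet> u = v \<bullet> (M *v u)"
  using dot_lmul_matrix[of v M u] by (simp_all add: inner_commute)

lemma linearized_field_self_adjoint:
  assumes "\<And>k y u v. u \<bullet> (jacobian (\<Phi> k) (at y) *v v) = (jacobian (\<Phi> k) (at y) *v u) \<bullet> v"
  shows "u \<bullet> linearized_field A K \<Phi> x v = linearized_field A K \<Phi> x u \<bullet> v"
  unfolding linearized_field_def
  by (simp add: inner_diff_left inner_diff_right inner_sum_left inner_sum_right
      inner_transpose_matrix_vector assms del: transpose_matrix_vector)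

lemma matrix_vector_mult_lipschitz:
  fixes M :: "real^'n^'m" and g :: "'a::metric_space \<Rightarrow> real^'n"
  assumes "\<exists>L. L-lipschitz_on UNIV g"
  shows "\<exists>L. L-lipschitz_on UNIV (\<lambda>x. M *v g x)"
proof -
  obtain B where "B-lipschitz_on (range g) ((*v) M)"
    using bounded_linear.lipschitz_boundE[OF matrix_vector_mul_bounded_linear] by metis
  then show ?thesis using assms lipschitz_on_compose2 by blast
qed

lemma vector_field_lipschitz:
  assumes "\<And>k. \<exists>L. L-lipschitz_on UNIV (\<Phi> k)"
  obtains L where "L-lipschitz_on UNIV (vector_field A b K \<Phi>)"
proof -
  note mat = matrix_vector_mult_lipschitz
  have id: "\<exists>L. L-lipschitz_on UNIV (\<lambda>x. x)"
    by (blast intro: lipschitz_on_id)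
  have "\<exists>L. L-lipschitz_on UNIV (\<lambda>x. \<Phi> k (K $ k *v x))" for k
  proof -
    obtain B where "B-lipschitz_on UNIV (\<lambda>x. K $ k *v x)"
      using mat[OF id, of "K $ k"] by blast
    moreover obtain C where "C-lipschitz_on UNIV (\<Phi> k)"
      using assms by blast
    ultimately have "(C * B)-lipschitz_on UNIV (\<lambda>x. \<Phi> k (K $ k *v x))"
      by (intro lipschitz_on_compose2) (auto intro: lipschitz_on_subset)
    then show ?thesis ..
  qed
  then have "\<exists>L. L-lipschitz_on UNIV (\<lambda>x. transpose (K $ k) *v \<Phi> k (K $ k *v x))" for k
    by (rule mat)
  then obtain L where L: "\<And>k. (L k)-lipschitz_on UNIV (\<lambda>x. transpose (K $ k) *v \<Phi> k (K $ k *v x))"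
    by metis
  have "(\<Sum>k\<in>S. L k)-lipschitz_on UNIV (\<lambda>x. \<Sum>k\<in>S. transpose (K $ k) *v \<Phi> k (K $ k *v x))"
    if "finite S" for S
    using that
    by induction
       (auto intro: lipschitz_on_constant lipschitz_on_add L simp del: transpose_matrix_vector)
  from this[of UNIV] have sum: "(\<Sum>k\<in>UNIV. L k)-lipschitz_on UNIV
      (\<lambda>x. \<Sum>k\<in>UNIV. transpose (K $ k) *v \<Phi> k (K $ k *v x))"
    by simp
  obtain B where "B-lipschitz_on UNIV (\<lambda>x. A *v x)"
    using mat[OF id, of A] by blast
  then have "(B + 0)-lipschitz_on UNIV (\<lambda>x. A *v x - b)"
    by (intro lipschitz_on_diff lipschitz_on_constant)
  then obtain C where "C-lipschitz_on UNIV (\<lambda>x. transpose A *v (A *v x - b))"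
    using mat by blast
  then have "(C + (\<Sum>k\<in>UNIV. L k))-lipschitz_on UNIV (\<lambda>x. - (transpose A *v (A *v x - b))
      - (\<Sum>k\<in>UNIV. transpose (K $ k) *v \<Phi> k (K $ k *v x)))"
    by (intro lipschitz_on_diff lipschitz_on_minus sum)
  then show ?thesis
    by (intro that) (simp add: vector_field_def[abs_def])
qed

section \<open>Solutions of autonomous differential equations\<close>

text \<open>
  Uniqueness by Gronwall's argument: \<open>exp (- 2 L t)\<close> times the squared distance of the solutions
  is nonincreasing, and it vanishes at the initial time.
\<close>

lemma lipschitz_ode_unique:
  fixes f :: "'a::real_inner \<Rightarrow> 'a"
  assumes lip: "L-lipschitz_on UNIV f"
    and x: "continuous_on {a..b} x" "\<And>t. t \<in> {a<..<b} \<Longrightarrow> (x has_vector_derivative f (x t)) (at t)"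
    and y: "continuous_on {a..b} y" "\<And>t. t \<in> {a<..<b} \<Longrightarrow> (y has_vector_derivative f (y t)) (at t)"
    and "x a = y a" and "a \<le> b"
  shows "x b = y b"
proof -
  define d where "d t = exp (- 2 * L * t) * ((x t - y t) \<bullet> (x t - y t))" for t
  have "d b \<le> d a"
  proof (rule DERIV_nonpos_imp_decreasing_open[OF \<open>a \<le> b\<close>])
    show "continuous_on {a..b} d"
      unfolding d_def by (intro continuous_intros x y)
    fix t assume "a < t" "t < b"
    then have t: "t \<in> {a<..<b}" by simp
    define z z' where "z = x t - y t" and "z' = f (x t) - f (y t)"
    have diff: "((\<lambda>t. x t - y t) has_derivative (\<lambda>h. h *\<^sub>R z')) (at t)"
      using has_vector_derivative_diff[OF x(2)[OF t] y(2)[OF t]]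
      by (simp add: has_vector_derivative_def z'_def)
    have "((\<lambda>t. (x t - y t) \<bullet> (x t - y t)) has_derivative (\<lambda>h. z \<bullet> (h *\<^sub>R z') + (h *\<^sub>R z') \<bullet> z)) (at t)"
      using has_derivative_inner[OF diff diff] by (simp add: z_def)
    then have sq: "((\<lambda>t. (x t - y t) \<bullet> (x t - y t)) has_real_derivative 2 * (z \<bullet> z')) (at t)"
      by (rule has_derivative_imp_has_field_derivative) (simp add: inner_commute algebra_simps)
    have "(d has_real_derivative exp (- 2 * L * t) * (2 * (z \<bullet> z') - 2 * L * (z \<bullet> z))) (at t)"
      unfolding d_def
      by (rule derivative_eq_intros sq refl | simp add: z_def algebra_simps)+
    moreover have "exp (- 2 * L * t) * (2 * (z \<bullet> z') - 2 * L * (z \<bullet> z)) \<le> 0"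
    proof -
      have "z \<bullet> z' \<le> norm z * norm z'" by (rule norm_cauchy_schwarz)
      also have "\<dots> \<le> norm z * (L * norm z)"
        using lipschitz_on_normD[OF lip] unfolding z_def z'_def by (intro mult_left_mono) auto
      also have "\<dots> = L * (z \<bullet> z)" by (simp add: dot_square_norm power2_eq_square)
      finally show ?thesis by (intro mult_nonneg_nonpos) auto
    qed
    ultimately show "\<exists>y. DERIV d t :> y \<and> y \<le> 0" by blast
  qed
  moreover have "d a = 0" using \<open>x a = y a\<close> by (simp add: d_def)
  ultimately have "(x b - y b) \<bullet> (x b - y b) \<le> 0"
    by (simp add: d_def mult_le_0_iff)
  then show ?thesis by (metis inner_ge_zero inner_eq_zero_iff order_antisym right_minus_eq)
qed

text \<open>
  A continuous function whose derivative extends continuously to the endpoints is differentiable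
  there, since it is the integral of that extension.
\<close>

lemma has_vector_derivative_closed_interval:
  fixes x :: "real \<Rightarrow> 'a::banach"
  assumes x: "continuous_on {a..b} x" "\<And>t. t \<in> {a<..<b} \<Longrightarrow> (x has_vector_derivative g t) (at t)"
    and g: "continuous_on {a..b} g"
    and t: "t \<in> {a..b}"
  shows "(x has_vector_derivative g t) (at t within {a..b})"
proof -
  have eq: "x a + integral {a..u} g = x u" if u: "u \<in> {a..b}" for u
  proof -
    have "(g has_integral (x u - x a)) {a..u}"
      using u x by (intro fundamental_theorem_of_calculus_interior) (auto intro: continuous_on_subset)
    then show ?thesis by (simp add: integral_unique)
  qed
  have "((\<lambda>u. x a + integral {a..u} g) has_vector_derivative 0 + g t) (at t within {a..b})"
    by (intro has_vector_derivative_add has_vector_derivative_const integral_has_vector_derivative g t)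
  then have "((\<lambda>u. x a + integral {a..u} g) has_vector_derivative g t) (at t within {a..b})"
    by simp
  then show ?thesis
    by (rule has_vector_derivative_transform[OF t, rotated]) (simp add: eq)
qed

section \<open>The dependence of the cost on the end time\<close>

lemma state_has_vector_derivative:
  assumes "is_state A b x0 T K \<Phi> x" and "continuous_on UNIV (vector_field A b K \<Phi>)"
    and "t \<in> {0..1}"
  shows "(x has_vector_derivative T *\<^sub>R vector_field A b K \<Phi> (x t)) (at t within {0..1})"
proof (rule has_vector_derivative_closed_interval[OF _ _ _ \<open>t \<in> {0..1}\<close>])
  show cont: "continuous_on {0..1} x"
    and "\<And>t. t \<in> {0<..<1} \<Longrightarrow> (x has_vector_derivative T *\<^sub>R vector_field A b K \<Phi> (x t)) (at t)"
    using assms by (auto simp: is_state_def)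
  show "continuous_on {0..1} (\<lambda>t. T *\<^sub>R vector_field A b K \<Phi> (x t))"
    by (intro continuous_intros continuous_on_compose2[OF assms(2) cont]) auto
qed

lemma is_state_rescale:
  assumes x: "is_state A b x0 T K \<Phi> x" and f: "continuous_on UNIV (vector_field A b K \<Phi>)"
    and c: "0 \<le> c" "c \<le> 1"
  shows "is_state A b x0 (c * T) K \<Phi> (\<lambda>t. x (c * t))"
  unfolding is_state_def
proof (intro conjI ballI)
  have sub: "(\<lambda>t. c * t) ` {0..1} \<subseteq> {0..1}"
    using c by (auto simp: mult_le_one)
  have "continuous_on {0..1} x" using x by (simp add: is_state_def)
  then show "continuous_on {0..1} (\<lambda>t. x (c * t))"
    by (rule continuous_on_compose2[OF _ _ sub]) (intro continuous_intros)
  show "x (c * 0) = x0" using x by (simp add: is_state_def)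
  fix t :: real assume t: "t \<in> {0<..<1}"
  have "((\<lambda>t. c * t) has_vector_derivative c) (at t within {0..1})"
    by (auto intro!: derivative_eq_intros simp: has_real_derivative_iff_has_vector_derivative[symmetric])
  moreover have "(x has_vector_derivative T *\<^sub>R vector_field A b K \<Phi> (x (c * t)))
                 (at (c * t) within (\<lambda>t. c * t) ` {0..1})"
    using t c
    by (intro has_vector_derivative_within_subset[OF state_has_vector_derivative[OF x f] sub])
       (auto simp: mult_le_one)
  ultimately have "((\<lambda>t. x (c * t)) has_vector_derivative c *\<^sub>R T *\<^sub>R vector_field A b K \<Phi> (x (c * t)))
                   (at t within {0..1})"
    using vector_diff_chain_within by (fastforce simp: o_def)
  then show "((\<lambda>t. x (c * t)) has_vector_derivative (c * T) *\<^sub>R vector_field A b K \<Phi> (x (c * t))) (at t)"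
    using t by (simp add: at_within_Icc_at)
qed

lemma cost_eq:
  assumes x: "is_state A b x0 T K \<Phi> x" and f: "L-lipschitz_on UNIV (vector_field A b K \<Phi>)"
  shows "cost A b x0 xg T K \<Phi> = 1 / 2 * (norm (x 1 - xg))\<^sup>2"
proof -
  define y where "y = (SOME x. is_state A b x0 T K \<Phi> x)"
  have y: "is_state A b x0 T K \<Phi> y"
    unfolding y_def by (rule someI[of _ x]) (rule x)
  have "(\<bar>T\<bar> * L)-lipschitz_on UNIV (\<lambda>u. T *\<^sub>R vector_field A b K \<Phi> u)"
    using f by (rule lipschitz_on_cmult)
  then have "y 1 = x 1"
    by (rule lipschitz_ode_unique[where a = 0]) (use x y in \<open>auto simp: is_state_def\<close>)
  then show ?thesis by (simp add: cost_def y_def[symmetric])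
qed

text \<open>
  The states for end times in \<open>{0..T}\<close> are rescalings of the one state \<open>x\<close>; this determines the
  derivative from the left, and hence the derivative once the latter is known to exist.
\<close>

lemma cost_derivative_time:
  assumes x: "is_state A b x0 T K \<Phi> x" and lip: "L-lipschitz_on UNIV (vector_field A b K \<Phi>)"
    and "0 < T"
    and D: "((\<lambda>\<tau>. cost A b x0 xg \<tau> K \<Phi>) has_real_derivative D) (at T)"
  shows "D = (x 1 - xg) \<bullet> vector_field A b K \<Phi> (x 1)"
proof -
  define f where "f = vector_field A b K \<Phi>"
  have f: "continuous_on UNIV f"
    using lip unfolding f_def by (rule lipschitz_on_continuous_on)
  define c where "c \<tau> = 1 / 2 * ((x (\<tau> / T) - xg) \<bullet> (x (\<tau> / T) - xg))" for \<tau>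
  have cost: "cost A b x0 xg \<tau> K \<Phi> = c \<tau>" if "\<tau> \<in> {0..T}" for \<tau>
  proof -
    have "is_state A b x0 \<tau> K \<Phi> (\<lambda>t. x (\<tau> / T * t))"
      using is_state_rescale[OF x f[unfolded f_def], of "\<tau> / T"] that \<open>0 < T\<close> by simp
    from cost_eq[OF this lip] show ?thesis
      by (simp add: c_def power2_norm_eq_inner)
  qed
  have img: "(\<lambda>\<tau>. \<tau> / T) ` {0..T} \<subseteq> {0..1}"
    using \<open>0 < T\<close> by auto
  have "((\<lambda>\<tau>. \<tau> / T) has_vector_derivative 1 / T) (at T within {0..T})"
    using \<open>0 < T\<close>
    by (auto intro!: derivative_eq_intros simp: has_real_derivative_iff_has_vector_derivative[symmetric])
  moreover have "(x has_vector_derivative T *\<^sub>R f (x 1)) (at (T / T) within (\<lambda>\<tau>. \<tau> / T) ` {0..T})"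
    using has_vector_derivative_within_subset[OF state_has_vector_derivative[OF x, of 1] img]
      f \<open>0 < T\<close> by (simp add: f_def)
  ultimately have "((x \<circ> (\<lambda>\<tau>. \<tau> / T)) has_vector_derivative (1 / T) *\<^sub>R T *\<^sub>R f (x 1)) (at T within {0..T})"
    by (rule vector_diff_chain_within)
  then have "((\<lambda>\<tau>. x (\<tau> / T) - xg) has_vector_derivative f (x 1) - 0) (at T within {0..T})"
    using \<open>0 < T\<close> by (intro has_vector_derivative_diff has_vector_derivative_const) (simp add: o_def)
  then have diff: "((\<lambda>\<tau>. x (\<tau> / T) - xg) has_derivative (\<lambda>h. h *\<^sub>R f (x 1))) (at T within {0..T})"
    by (simp add: has_vector_derivative_def)
  have "(c has_derivative (\<lambda>h. 1 / 2 * ((x 1 - xg) \<bullet> (h *\<^sub>R f (x 1)) + (h *\<^sub>R f (x 1)) \<bullet> (x 1 - xg))))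
        (at T within {0..T})"
    unfolding c_def
    using has_derivative_mult_right[OF has_derivative_inner[OF diff diff], of "1 / 2"] \<open>0 < T\<close> by simp
  then have "(c has_real_derivative (x 1 - xg) \<bullet> f (x 1)) (at T within {0..T})"
    by (rule has_derivative_imp_has_field_derivative) (simp add: inner_commute)
  then have c: "(c has_vector_derivative (x 1 - xg) \<bullet> f (x 1)) (at T within {0..T})"
    by (simp add: has_real_derivative_iff_has_vector_derivative)
  have "((\<lambda>\<tau>. cost A b x0 xg \<tau> K \<Phi>) has_vector_derivative D) (at T within {0..T})"
    using D has_real_derivative_iff_has_vector_derivative has_vector_derivative_at_within by blast
  then have "(c has_vector_derivative D) (at T within {0..T})"
    by (rule has_vector_derivative_transform[rotated 2]) (use cost \<open>0 < T\<close> in auto)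
  from vector_derivative_unique_within_closed_interval[of 0 T T c, unfolded cbox_interval, OF _ _ this c]
  show ?thesis
    using \<open>0 < T\<close> by (simp add: f_def)
qed

section \<open>The conserved quantity\<close>

text \<open>
  The adjoint equation is the linearized state equation run backwards, and self-adjointness makes
  the two terms of the product rule opposite.
\<close>

lemma adjoint_inner_vector_field_constant:
  assumes x: "is_state A b x0 T K \<Phi> x" and p: "is_adjoint_state A xg T K \<Phi> x p"
    and \<Phi>: "\<And>k y. (\<Phi> k has_derivative (\<lambda>h. jacobian (\<Phi> k) (at y) *v h)) (at y)"
    and sym: "\<And>k y u v. u \<bullet> (jacobian (\<Phi> k) (at y) *v v) = (jacobian (\<Phi> k) (at y) *v u) \<bullet> v"
    and t: "t \<in> {0..1}"
  shows "p t \<bullet> vector_field A b K \<Phi> (x t) = (xg - x 1) \<bullet> vector_field A b K \<Phi> (x 1)"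
proof -
  define f where "f = vector_field A b K \<Phi>"
  define f' where "f' = linearized_field A K \<Phi>"
  define g where "g t = p t \<bullet> f (x t)" for t
  have f: "(f has_derivative f' u) (at u)" for u
    unfolding f_def f'_def by (rule vector_field_has_derivative[OF \<Phi>])
  have p': "(p has_vector_derivative - T *\<^sub>R f' (x t) (p t)) (at t within {0..1})" if "t \<in> {0..1}" for t
  proof -
    have "(\<Sum>k\<in>UNIV. T *\<^sub>R (transpose (K $ k) *v
             (jacobian (\<Phi> k) (at (K $ k *v x t)) *v (K $ k *v p t))))
          + T *\<^sub>R (transpose A *v (A *v p t)) = - T *\<^sub>R f' (x t) (p t)"
      unfolding f'_def linearized_field_def
      by (simp add: scaleR_sum_right[symmetric] scaleR_diff_right algebra_simps)
    moreover have "(p has_vector_derivative (\<Sum>k\<in>UNIV. T *\<^sub>R (transpose (K $ k) *v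
             (jacobian (\<Phi> k) (at (K $ k *v x t)) *v (K $ k *v p t))))
          + T *\<^sub>R (transpose A *v (A *v p t))) (at t within {0..1})"
      using p that unfolding is_adjoint_state_def by blast
    ultimately show ?thesis by simp
  qed
  have cont_f: "continuous_on UNIV f"
    using f by (rule has_derivative_continuous_on)
  have cont_x: "continuous_on {0..1} x"
    using x by (simp add: is_state_def)
  have cont_p: "continuous_on {0..1} p"
    using p' has_vector_derivative_continuous continuous_on_eq_continuous_within by blast
  have cont: "continuous_on {0..1} g"
    unfolding g_def
    by (intro continuous_intros cont_p continuous_on_compose2[OF cont_f cont_x]) auto
  have der: "(g has_real_derivative 0) (at s)" if "0 < s" "s < 1" for s
  proof -
    have xs: "(x has_derivative (\<lambda>h. h *\<^sub>R T *\<^sub>R f (x s))) (at s)"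
      using x that by (simp add: is_state_def has_vector_derivative_def f_def)
    have ps: "(p has_derivative (\<lambda>h. h *\<^sub>R - T *\<^sub>R f' (x s) (p s))) (at s)"
      using p'[of s] that by (simp add: has_vector_derivative_def at_within_Icc_at)
    have "(g has_derivative (\<lambda>h. p s \<bullet> f' (x s) (h *\<^sub>R T *\<^sub>R f (x s))
            + (h *\<^sub>R - T *\<^sub>R f' (x s) (p s)) \<bullet> f (x s))) (at s)"
      unfolding g_def by (rule has_derivative_inner[OF ps has_derivative_compose[OF xs f]])
    moreover have "p s \<bullet> f' (x s) v = f' (x s) (p s) \<bullet> v" for v
      unfolding f'_def by (rule linearized_field_self_adjoint[OF sym])
    ultimately show ?thesis
      by (intro has_derivative_imp_has_field_derivative) (assumption, simp)
  qed
  have const: "g u = g 0" if "u \<in> {0..1}" for u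
    using DERIV_isconst2[OF _ cont der, of u] that by simp
  have "g t = g 1" using const[OF t] const[of 1] by simp
  moreover have "p 1 = xg - x 1" using p by (simp add: is_adjoint_state_def)
  ultimately show ?thesis by (simp add: g_def f_def)
qed

section \<open>Stationarity\<close>

text \<open>
  In the direction of \<open>T\<close> only the multiplier of \<open>0 \<le> T\<close> contributes: the derivatives of the
  constraints on \<open>K\<close> and \<open>\<Phi>\<close> are linear and vanish at the zero direction.
\<close>

lemma stationary_point_time_derivative:
  assumes "stationary_point A b x0 xg Tmax \<psi> \<alpha> \<beta> T K \<Phi>"
    and \<alpha>: "constraint_function \<alpha>" and \<beta>: "activation_constraint_function \<psi> \<beta>"
  obtains D where "((\<lambda>\<tau>. cost A b x0 xg \<tau> K \<Phi>) has_real_derivative D) (at T)" and "D * T = 0"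
proof -
  obtain w \<eta>0 \<mu> \<nu> \<xi> where w: "\<And>k. \<Phi> k = activation \<psi> (w $ k)"
    and kkt: "kkt_system A b x0 xg Tmax \<psi> \<alpha> \<beta> T K w \<eta>0 0 \<mu> \<nu> \<xi>"
    using assms(1) unfolding stationary_point_def by blast
  obtain J' where J': "((\<lambda>(T, K, w). cost A b x0 xg T K (\<lambda>k. activation \<psi> (w $ k)))
              has_derivative J') (at (T, K, w))"
    and stat: "\<And>dT dK dw. J' (dT, dK, dw) - \<eta>0 * dT + 0 * dT
           + (\<Sum>k\<in>UNIV. \<mu> $ k * frechet_derivative \<alpha> (at (K $ k)) (dK $ k))
           + (\<Sum>k\<in>UNIV. \<nu> $ k *
                frechet_derivative (\<lambda>v. \<beta> (activation \<psi> v)) (at (w $ k)) (dw $ k))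
           + (\<Sum>k\<in>UNIV. \<xi> $ k \<bullet> (dK $ k *v vec 1)) = 0"
    and comp: "\<eta>0 * T = 0"
    using kkt unfolding kkt_system_def by blast
  have zero: "frechet_derivative h (at u) 0 = 0" if "constraint_function h"
    for h :: "'z::euclidean_space \<Rightarrow> real" and u
  proof -
    have "h differentiable (at u)"
      using that by (auto simp: constraint_function_def gderiv_def differentiable_def)
    then show ?thesis
      by (metis frechet_derivative_works has_derivative_linear linear_0)
  qed
  have J0: "J' (1, 0, 0) = \<eta>0"
    using stat[of 1 0 0] zero[OF \<alpha>] zero[OF \<beta>[unfolded activation_constraint_function_def]]
    by simp
  have path: "((\<lambda>\<tau>. (\<tau>, K, w)) has_derivative (\<lambda>h. (h, 0, 0))) (at T)"
    by (intro has_derivative_Pair has_derivative_ident has_derivative_const)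
  have \<Phi>: "\<Phi> = (\<lambda>k. activation \<psi> (w $ k))"
    using w by (rule ext)
  have d: "((\<lambda>\<tau>. cost A b x0 xg \<tau> K \<Phi>) has_derivative (\<lambda>h. J' (h, 0, 0))) (at T)"
    using has_derivative_compose[of "\<lambda>\<tau>. (\<tau>, K, w)", OF path J'] by (simp add: \<Phi>)
  have "J' (h, 0, 0) = \<eta>0 * h" for h
    using linear_scale[OF has_derivative_linear[OF J'], of h "(1, 0, 0)"] J0 by simp
  with d have "((\<lambda>\<tau>. cost A b x0 xg \<tau> K \<Phi>) has_real_derivative \<eta>0) (at T)"
    by (simp add: has_field_derivative_def)
  then show ?thesis using comp by (rule that)
qed

theorem theorem2p2:
  fixes A :: "real^'n^'l" and b :: "real^'l" and x0 xg :: "real^'n"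
    and Tmax lo hi T :: real and s :: nat
    and \<psi> :: "'w::finite \<Rightarrow> real \<Rightarrow> real"
    and \<alpha> :: "real^'n^'m \<Rightarrow> real" and \<beta> :: "(real^'m \<Rightarrow> real^'m) \<Rightarrow> real"
    and K :: "real^'n^'m^'k" and \<Phi> :: "'k \<Rightarrow> real^'m \<Rightarrow> real^'m"
    and x p :: "real \<Rightarrow> real^'n"
  assumes "s \<ge> 1" and "Tmax > 0" and "lo < hi"
    and "basis_functions s lo hi \<psi>"
    and "constraint_function \<alpha>"
    and "activation_constraint_function \<psi> \<beta>"
    and "\<forall>k. \<Phi> k \<in> activation_space \<psi>"
    and "stationary_point A b x0 xg Tmax \<psi> \<alpha> \<beta> T K \<Phi>"
    and "0 \<le> T" and "T \<le> Tmax"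
    and "\<forall>k. \<alpha> (K $ k) \<le> 1 \<and> \<beta> (\<Phi> k) \<le> 1 \<and> K $ k *v vec 1 = 0"
    and "is_state A b x0 T K \<Phi> x"
    and "is_adjoint_state A xg T K \<Phi> x p"
  shows "((\<lambda>t. p t \<bullet> vector_derivative x (at t)) has_integral 0) {0..1}"
proof -
  define f where "f = vector_field A b K \<Phi>"
  have "\<forall>k. \<exists>v. \<Phi> k = activation \<psi> v"
    using assms(7) by (auto simp: activation_space_def)
  then obtain w where w: "\<And>k. \<Phi> k = activation \<psi> (w k)"
    using choice[of "\<lambda>k v. \<Phi> k = activation \<psi> v"] by blast
  note jac = activation_jacobian[OF assms(4,1)]
  have "\<exists>L. L-lipschitz_on UNIV (\<Phi> k)" for k
    unfolding w by (rule activation_lipschitz[OF assms(4,1)]) blast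
  then obtain L where lip: "L-lipschitz_on UNIV f"
    unfolding f_def by (rule vector_field_lipschitz)
  obtain D where D: "((\<lambda>\<tau>. cost A b x0 xg \<tau> K \<Phi>) has_real_derivative D) (at T)" "D * T = 0"
    by (rule stationary_point_time_derivative[OF assms(8,5,6)])
  have final: "T * ((xg - x 1) \<bullet> f (x 1)) = 0"
  proof (cases "T = 0")
    case False
    then have "D = (x 1 - xg) \<bullet> f (x 1)"
      using cost_derivative_time[OF assms(12) lip[unfolded f_def] _ D(1)] \<open>0 \<le> T\<close>
      by (simp add: f_def)
    then show ?thesis using D(2) False by (simp add: inner_diff_left)
  qed simp
  have vanish: "p t \<bullet> vector_derivative x (at t) = 0" if "t \<in> {0<..<1}" for t
  proof -
    have "(x has_vector_derivative T *\<^sub>R f (x t)) (at t)"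
      using assms(12) that by (simp add: is_state_def f_def)
    then have "p t \<bullet> vector_derivative x (at t) = T * (p t \<bullet> f (x t))"
      by (simp add: vector_derivative_at)
    also have "p t \<bullet> f (x t) = (xg - x 1) \<bullet> f (x 1)"
      unfolding f_def
      using that by (intro adjoint_inner_vector_field_constant[OF assms(12,13)]) (auto simp: w jac)
    finally show ?thesis using final by simp
  qed
  \<comment> \<open>The state equation says nothing about the two-sided derivative of \<open>x\<close> at 0 and 1.\<close>
  show ?thesis
    by (rule has_integral_spike_finite[of "{0, 1}" "{0..1}" _ "\<lambda>_. 0"]) (use vanish in auto)
qed

end
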